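(* Let $U$ be a measurable function on $(0,\infty)$ whose Mellin transform $MU(z)$ converges at least in the strip $\sigma\le\Re(z)\le\tau$, where $-\infty<\sigma<\tau<\infty$. Let $f$ be a measurable function on $(0,\infty)$, and assume the following conditions hold: 1. $f(x)=x^{\rho}l(x)(1+O(h(x)))$ as $x\to\infty$, where $\rho\in(\sigma,\tau)$, $l\in R_0^g$ with $g\in R_0$, and $h\in\mathcal{Z}$. The functions $g$ and $h$ satisfy $g(x)\to0$ and $h(x)\to0$ as $x\to\infty$. 2. The functions $g$, $l^{-1}$ and $g^{-1}$ are locally bounded on the interval $(x_0,\infty)$ for some $x_0>0$. 3. The function $x\mapsto x^{-\sigma}f(x)$ is bounded on every interval $(0,a]$ where $a>0$. Then $$(U\stackrel{M}{\star}f)(x)=MU(\rho)\,[x^{\rho}l(x)]\,\bigl(1+O(g(x))+O(h(x))\bigr)\qquad\text{as }x\to\infty.$$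
   Context: Mellin transform: $MU(z)=\int_0^\infty t^{-z}U(t)\,\frac{dt}{t}$, with domain the set of all $z\in\mathbb{C}$ for which the integral converges absolutely. Mellin convolution of two real Lebesgue measurable functions on $(0,\infty)$: $(f\stackrel{M}{\star}g)(x)=\int_0^\infty f(t^{-1}x)g(t)\frac{dt}{t}$ for those $x>0$ for which the integral exists. $R_0$ (slowly varying functions): nonnegative measurable functions $f$ on $(0,\infty)$ with $f(\lambda x)/f(x)\to1$ as $x\to\infty$ for every $\lambda>0$. $R_0^g$ (slowly varying functions with remainder $g$, where $g$ is a nonnegative measurable function on $(0,\infty)$ with $g(x)\to0$ as $x\to\infty$): nonnegative measurable functions $l$ on $(0,\infty)$ such that for all $\lambda>1$, $\frac{l(\lambda x)}{l(x)}-1=O(g(x))$ as $x\to\infty$. Zygmund class $\mathcal{Z}$: nonnegative measurable functions $l$ on $(0,\infty)$ such that for every $\alpha>0$ the function $x^{\alpha}l(x)$ is ultimately increasing and the function $x^{-\alpha}l(x)$ is ultimately decreasing. $\phi_1(x)=O(\phi_2(x))$ as $x\to\infty$ means: there exist $c>0$ and $x_0>0$ such that $|\phi_1(x)|\le c\,\phi_2(x)$ for all $x>x_0$.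
   Formalization: The multiplicative form is claimed only when MU(ρ)≠0, as it is false for MU(ρ)=0 (it would force the convolution to vanish for large x); for every MU(ρ) the form x^ρ l(x)(MU(ρ)+O(g(x))+O(h(x))) is stated instead. *)

theory Defs
  imports "HOL-Analysis.Analysis" "HOL-Library.Landau_Symbols"
begin

text \<open>
  Functions on \<open>(0, \<infinity>)\<close> are total functions on \<open>real\<close> whose values outside
  \<open>{0<..}\<close> are ignored. Measurable means Lebesgue measurable, and integrals are Lebesgue
  integrals, so existence of an integral is absolute convergence.
\<close>

definition mellin_domain :: "(real \<Rightarrow> real) \<Rightarrow> complex set" where
  "mellin_domain U =
     {z. integrable (lebesgue_on {0<..}) (\<lambda>t. of_real t powr (-z) * of_real (U t) / of_real t)}"

definition mellin :: "(real \<Rightarrow> real) \<Rightarrow> complex \<Rightarrow> complex" where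
  "mellin U z =
     integral\<^sup>L (lebesgue_on {0<..}) (\<lambda>t. of_real t powr (-z) * of_real (U t) / of_real t)"

definition mellin_conv_exists :: "(real \<Rightarrow> real) \<Rightarrow> (real \<Rightarrow> real) \<Rightarrow> real \<Rightarrow> bool" where
  "mellin_conv_exists f g x \<longleftrightarrow> integrable (lebesgue_on {0<..}) (\<lambda>t. f (x / t) * g t / t)"

definition mellin_conv :: "(real \<Rightarrow> real) \<Rightarrow> (real \<Rightarrow> real) \<Rightarrow> real \<Rightarrow> real" where
  "mellin_conv f g x = integral\<^sup>L (lebesgue_on {0<..}) (\<lambda>t. f (x / t) * g t / t)"

definition nonneg_measurable :: "(real \<Rightarrow> real) set" where
  "nonneg_measurable = {f \<in> borel_measurable (lebesgue_on {0<..}). \<forall>x>0. 0 \<le> f x}"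

text \<open>
  In the two definitions below, the convention \<open>y / 0 = 0\<close> admits no degenerate functions:
  either condition forces the denominator to be nonzero for all large \<open>x\<close> (in the second one
  because \<open>g\<close> tends to \<open>0\<close>).
\<close>

definition slowly_varying :: "(real \<Rightarrow> real) set" where
  "slowly_varying =
     {f \<in> nonneg_measurable. \<forall>c>0. ((\<lambda>x. f (c * x) / f x) \<longlongrightarrow> 1) at_top}"

definition slowly_varying_rem :: "(real \<Rightarrow> real) \<Rightarrow> (real \<Rightarrow> real) set" where
  "slowly_varying_rem g =
     {l \<in> nonneg_measurable. g \<in> nonneg_measurable \<and> (g \<longlongrightarrow> 0) at_top \<and>
        (\<forall>c>1. (\<lambda>x. l (c * x) / l x - 1) \<in> O[at_top](g))}"

text \<open>Increasing and decreasing are understood in the weak sense.\<close>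

definition zygmund :: "(real \<Rightarrow> real) set" where
  "zygmund =
     {l \<in> nonneg_measurable. \<forall>\<alpha>>0.
        (\<exists>X>0. mono_on {X<..} (\<lambda>x. x powr \<alpha> * l x)) \<and>
        (\<exists>X>0. antimono_on {X<..} (\<lambda>x. x powr (-\<alpha>) * l x))}"

definition locally_bounded_on :: "real set \<Rightarrow> (real \<Rightarrow> real) \<Rightarrow> bool" where
  "locally_bounded_on S f \<longleftrightarrow> (\<forall>K. compact K \<and> K \<subseteq> S \<longrightarrow> bounded (f ` K))"

text \<open>Since \<open>inverse 0 = 0\<close>, the reciprocal being defined has to be required explicitly.\<close>

definition locally_bounded_inverse_on :: "real set \<Rightarrow> (real \<Rightarrow> real) \<Rightarrow> bool" where
  "locally_bounded_inverse_on S f \<longleftrightarrow>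
     (\<forall>x\<in>S. f x \<noteq> 0) \<and> locally_bounded_on S (\<lambda>x. inverse (f x))"

end

(* The ratio estimates that define slow variation for each fixed dilation factor hold uniformly
   for factors in [1, 2] (a measure-theoretic argument), and dyadic iteration turns them into
   Potter bounds: for large x and y,
     |l y - l x| <= C g(x) l(x) ((y/x)^eps + (x/y)^eps),
   with analogous bounds for h. After the substitution t -> x/s the convolution is the integral of
   U(s) f(x/s) ds/s. Comparing f(x/s) with (x/s)^rho l(x) costs at most
     C x^rho l(x) (g(x) + h(x)) (s^-sigma + s^-tau),
   both where x/s is large (Potter) and where it is bounded (there x^(sigma - rho) is O(g(x) l(x)),
   since g l is slowly varying), and the weight is integrable against |U(s)| ds/s because sigma and
   tau lie in the Mellin domain. *)
theory Submission
  imports Defs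
begin

text \<open>The obstacle is that slow variation gives a constant and a threshold for each dilation
  factor separately, while the functions are merely measurable. A given factor \<open>\<mu>\<close>
  may therefore behave badly at the base point in question, and it is never tested directly:
  \<open>x\<close> and \<open>\<mu> * x\<close> are both compared with a common point
  \<open>c * x\<close>. This costs two comparisons, which explains the square roots and the factor 3
  in the constants. The uniformity lemma is stated for an abstract predicate \<open>P n x c\<close>,
  because \<open>n\<close> has two uses: for ratios it is only a threshold, for remainders it is
  threshold and constant at once. The exponent \<open>\<epsilon>\<close> is the distance from
  \<open>\<rho>\<close> to the boundary of the strip, so that the powers of \<open>s\<close> with
  exponents \<open>-\<rho> - \<epsilon>\<close> and \<open>-\<rho> + \<epsilon>\<close> are still
  dominated by the two boundary powers. Wherever two Potter factors are multiplied, each is taken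
  with \<open>\<epsilon> / 2\<close>. The integration yields a single error of size O(g + h);
  writing it as a sum of an O(g) and an O(h) is a separate algebraic step.\<close>

section \<open>Measurability and uniformity in the dilation factor\<close>

text \<open>Composition with a continuous map may destroy Lebesgue measurability. Here a preimage
  under \<open>\<phi>\<close> is an image under its inverse \<open>\<psi>\<close>, and
  differentiable maps of the line send Lebesgue sets to Lebesgue sets.\<close>

lemma measurable_inverse_differentiable:
  fixes \<phi> \<psi> :: "real \<Rightarrow> real"
  assumes S: "S \<in> sets lebesgue"
    and \<phi>: "\<And>x. x \<in> S \<Longrightarrow> \<phi> x \<in> S \<and> \<psi> (\<phi> x) = x"
    and \<psi>: "\<And>x. x \<in> S \<Longrightarrow> \<psi> x \<in> S \<and> \<phi> (\<psi> x) = x"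
    and d: "\<psi> differentiable_on S"
    and f: "f \<in> borel_measurable (lebesgue_on S)"
  shows "(\<lambda>x. f (\<phi> x)) \<in> borel_measurable (lebesgue_on S)"
proof -
  have "\<phi> \<in> measurable (lebesgue_on S) (lebesgue_on S)"
  proof (rule measurableI)
    fix A assume A: "A \<in> sets (lebesgue_on S)"
    then have "A \<in> sets lebesgue" "A \<subseteq> S"
      using S by (auto simp: sets_restrict_space_iff)
    moreover have "\<phi> -` A \<inter> S = \<psi> ` A"
      using \<phi> \<psi> \<open>A \<subseteq> S\<close> by (auto simp: subset_iff image_iff) metis
    moreover have "\<psi> ` A \<in> sets lebesgue"
      using d \<open>A \<subseteq> S\<close> \<open>A \<in> sets lebesgue\<close>
      by (intro differentiable_image_in_sets_lebesgue) (auto intro: differentiable_on_subset)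
    ultimately show "\<phi> -` A \<inter> space (lebesgue_on S) \<in> sets (lebesgue_on S)"
      using S by (auto simp: sets_restrict_space_iff)
  qed (use \<phi> in auto)
  from measurable_compose[OF this f] show ?thesis .
qed

lemma measurable_dilation:
  fixes f :: "real \<Rightarrow> real"
  assumes f: "f \<in> borel_measurable (lebesgue_on {0<..})" and x: "x > 0"
  shows "(\<lambda>t. f (t * x)) \<in> borel_measurable (lebesgue_on {0<..})"
proof (rule measurable_inverse_differentiable[OF _ _ _ _ f, where \<psi> = "\<lambda>t. t / x"])
  show "(\<lambda>t. t / x) differentiable_on {0<..}"
    using x by (auto simp: differentiable_on_def intro!: differentiable_divide)
qed (use x in auto)

lemma measurable_reflection:
  fixes f :: "real \<Rightarrow> real"
  assumes f: "f \<in> borel_measurable (lebesgue_on {0<..})" and x: "x > 0"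
  shows "(\<lambda>t. f (x / t)) \<in> borel_measurable (lebesgue_on {0<..})"
proof (rule measurable_inverse_differentiable[OF _ _ _ _ f, where \<psi> = "\<lambda>t. x / t"])
  show "(\<lambda>t. x / t) differentiable_on {0<..}"
    using x by (auto simp: differentiable_on_def intro!: differentiable_divide)
qed (use x in auto)

text \<open>The factors \<open>c\<close> that are bad for the base point \<open>x\<close> or for \<open>\<mu> * x\<close> fill a set of small
  measure, so some \<open>c\<close> compares both \<open>x\<close> and \<open>\<mu> * x\<close> with \<open>c * x\<close>.\<close>

lemma uniform_dilation:
  fixes P :: "nat \<Rightarrow> real \<Rightarrow> real \<Rightarrow> bool"
  assumes meas: "\<And>n x. x > 0 \<Longrightarrow> {c\<in>{1..8}. \<not> P n x c} \<in> sets lebesgue"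
    and ev: "\<And>c. c \<in> {1..8} \<Longrightarrow> \<exists>N. \<forall>n\<ge>N. \<forall>x\<ge>real N. P n x c"
  shows "\<exists>n. \<forall>x\<ge>real n. \<forall>\<mu>\<in>{1..2}. \<exists>c\<ge>\<mu>. P n x c \<and> P n (\<mu> * x) (c / \<mu>)"
proof (rule ccontr)
  assume "\<not> ?thesis"
  \<comment> \<open>The failure is taken at \<open>Suc n\<close> rather than \<open>n\<close>, so
    that every base point is positive and \<open>meas\<close> applies.\<close>
  then have "\<forall>n. \<exists>x \<mu>. x \<ge> real (Suc n) \<and> \<mu> \<in> {1..2} \<and>
      (\<forall>c\<ge>\<mu>. P (Suc n) x c \<longrightarrow> \<not> P (Suc n) (\<mu> * x) (c / \<mu>))"
    by blast
  then obtain x \<mu> where x: "\<And>n. x n \<ge> real (Suc n)" and \<mu>: "\<And>n. \<mu> n \<in> {1..2}"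
    and bad: "\<And>n c. c \<ge> \<mu> n \<Longrightarrow> P (Suc n) (x n) c \<Longrightarrow> \<not> P (Suc n) (\<mu> n * x n) (c / \<mu> n)"
    by metis
  have small: "\<forall>\<^sub>F n in sequentially. \<exists>B \<in> lmeasurable. measure lebesgue B < 1 \<and>
      {c\<in>{1..8}. \<not> P (Suc n) (y n) c} \<subseteq> B"
    if y: "\<And>n. y n \<ge> real (Suc n)" for y
  proof -
    \<comment> \<open>Tail unions make the bad sets decreasing, so continuity of measure from above
      applies. Their intersection is empty: by \<open>ev\<close>, a fixed \<open>c\<close> is good
      for all late indices, since \<open>y m\<close> exceeds the threshold too.\<close>
    define B where "B n = (\<Union>m\<in>{n..}. {c\<in>{1..8}. \<not> P (Suc m) (y m) c})" for n
    have y0: "y n > 0" for n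
      using y[of n] by linarith
    have B: "B n \<in> sets lebesgue" for n
      unfolding B_def by (intro sets.countable_UN'' meas y0) auto
    have sub: "B n \<subseteq> cbox 1 8" for n
      by (auto simp: B_def)
    have lm: "B n \<in> lmeasurable" for n
      by (rule fmeasurableI2[OF lmeasurable_cbox sub B])
    have "(\<lambda>n. measure lebesgue (B n)) \<longlonglongrightarrow> measure lebesgue (\<Inter>n. B n)"
    proof (rule Lim_measure_decseq)
      show "decseq B"
        by (rule decseq_SucI) (force simp: B_def)
      show "emeasure lebesgue (B n) \<noteq> \<infinity>" for n
        using fmeasurableD2[OF lm[of n]] by simp
    qed (use B in auto)
    moreover have "(\<Inter>n. B n) = {}"
    proof safe
      fix c assume *: "c \<in> (\<Inter>n. B n)"
      then have "c \<in> {1..8}"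
        using sub[of 0] by auto
      then obtain N where N: "\<forall>n\<ge>N. \<forall>x\<ge>real N. P n x c"
        using ev by blast
      from * have "c \<in> B N" by blast
      then obtain m where "m \<ge> N" "\<not> P (Suc m) (y m) c"
        by (auto simp: B_def)
      then show "c \<in> {}"
        using N y[of m] by auto
    qed
    ultimately have "(\<lambda>n. measure lebesgue (B n)) \<longlonglongrightarrow> 0"
      by simp
    then have "\<forall>\<^sub>F n in sequentially. measure lebesgue (B n) < 1"
      by (rule order_tendstoD) simp
    then show ?thesis
      by eventually_elim (use lm in \<open>force simp: B_def\<close>)
  qed
  have x0: "x n > 0" for n
    using x[of n] by linarith
  have \<mu>x: "\<mu> n * x n \<ge> real (Suc n)" for n
  proof -
    have "1 * x n \<le> \<mu> n * x n"
      using \<mu>[of n] x0[of n] by (intro mult_right_mono) auto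
    then show ?thesis using x[of n] by linarith
  qed
  obtain n A B where A: "A \<in> lmeasurable" "measure lebesgue A < 1"
      "{c\<in>{1..8}. \<not> P (Suc n) (x n) c} \<subseteq> A"
    and B: "B \<in> lmeasurable" "measure lebesgue B < 1"
      "{c\<in>{1..8}. \<not> P (Suc n) (\<mu> n * x n) c} \<subseteq> B"
    using eventually_happens'[OF _ eventually_conj[OF small[OF x] small[OF \<mu>x]]] by auto
  have \<mu>n: "1 \<le> \<mu> n" "\<mu> n \<le> 2"
    using \<mu>[of n] by auto
  \<comment> \<open>From \<open>2\<close> on, \<open>c / \<mu> n\<close> stays in
    \<open>{1..8}\<close> although \<open>\<mu> n\<close> may be as large as 2. If each
    \<open>c\<close> were bad for one of the two base points, a set of length 6 would be covered by
    sets of measure less than 1 and at most 2.\<close>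
  have "{2..8} \<subseteq> A \<union> (*\<^sub>R) (\<mu> n) ` B"
  proof
    fix c :: real assume c: "c \<in> {2..8}"
    have "c / \<mu> n \<in> {1..8}"
    proof -
      have "c / \<mu> n \<le> c / 1"
        using c \<mu>n by (intro divide_left_mono) auto
      moreover have "1 \<le> c / \<mu> n"
        using c \<mu>n by (simp add: field_simps)
      ultimately show ?thesis using c by auto
    qed
    moreover have "c \<in> {1..8}" "c \<ge> \<mu> n"
      using c \<mu>n by auto
    ultimately have "c \<in> A \<or> c / \<mu> n \<in> B"
      using bad[of n c] A(3) B(3) by blast
    then show "c \<in> A \<union> (*\<^sub>R) (\<mu> n) ` B"
      using \<mu>n by (auto intro!: image_eqI[of _ _ "c / \<mu> n"])
  qed
  moreover have mB: "(*\<^sub>R) (\<mu> n) ` B \<in> lmeasurable"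
  proof (rule fmeasurableI)
    show "(*\<^sub>R) (\<mu> n) ` B \<in> sets lebesgue"
      using B by (intro differentiable_image_in_sets_lebesgue) (auto intro!: linear_imp_differentiable_on)
    show "emeasure lebesgue ((*\<^sub>R) (\<mu> n) ` B) < \<infinity>"
      using emeasure_lebesgue_affine[of "\<mu> n" 0 B] fmeasurableD2[OF B(1)]
      by (simp add: ennreal_mult_less_top less_top)
  qed
  ultimately have "measure lebesgue {2..8::real} \<le> measure lebesgue (A \<union> (*\<^sub>R) (\<mu> n) ` B)"
    using A by (intro measure_mono_fmeasurable) auto
  also have "\<dots> \<le> measure lebesgue A + measure lebesgue ((*\<^sub>R) (\<mu> n) ` B)"
    using A mB by (intro measure_Un_le) auto
  also have "measure lebesgue ((*\<^sub>R) (\<mu> n) ` B) = \<mu> n * measure lebesgue B"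
    using measure_lebesgue_affine[of "\<mu> n" 0 B] \<mu>n by simp
  also have "\<dots> \<le> 2 * 1"
    using B \<mu>n by (intro mult_mono) auto
  finally show False
    using A by simp
qed

lemma sets_lebesgue_of_pred:
  assumes "Measurable.pred (lebesgue_on {0<..}) Q"
  shows "{c\<in>{1..8::real}. Q c} \<in> sets lebesgue"
proof -
  have "{c \<in> space (lebesgue_on {0<..}). Q c} \<in> sets (lebesgue_on {0<..})"
    using assms by measurable
  then have "{c \<in> {0<..}. Q c} \<in> sets lebesgue"
    by (simp add: sets_restrict_space_iff)
  then have "{c \<in> {0<..}. Q c} \<inter> {1..8} \<in> sets lebesgue"
    by (intro sets.Int) auto
  also have "{c \<in> {0<..}. Q c} \<inter> {1..8} = {c\<in>{1..8}. Q c}"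
    by auto
  finally show ?thesis .
qed

lemma dyadic_induct [consumes 1]:
  fixes c :: real
  assumes c: "c \<ge> 1"
    and base: "\<And>c. c \<in> {1..2} \<Longrightarrow> Q c"
    and step: "\<And>c. c \<ge> 1 \<Longrightarrow> Q c \<Longrightarrow> Q (2 * c)"
  shows "Q c"
proof -
  have *: "c \<ge> 1 \<Longrightarrow> c \<le> 2 ^ n \<Longrightarrow> Q c" for n c
  proof (induction n arbitrary: c)
    case 0
    then show ?case using base by simp
  next
    case (Suc n)
    show ?case
    proof (cases "c \<le> 2")
      case False
      then have "Q (c / 2)"
        using Suc.prems by (intro Suc.IH) auto
      then show ?thesis
        using step[of "c / 2"] False by simp
    qed (use base Suc.prems in auto)
  qed
  obtain n where "c < 2 ^ n"
    using real_arch_pow[of 2 c] by auto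
  then show ?thesis
    using *[of c n] c by simp
qed

section \<open>Potter bounds for slowly varying functions\<close>

lemma slowly_varying_pos:
  assumes "f \<in> slowly_varying"
  shows "\<forall>\<^sub>F x in at_top. 0 < f x"
proof -
  \<comment> \<open>With factor 1 the quotient is 1 where \<open>f x\<close> is nonzero and 0
    elsewhere, so the limit 1 excludes zeros of \<open>f\<close> for large \<open>x\<close>.\<close>
  have "((\<lambda>x. f (1 * x) / f x) \<longlongrightarrow> 1) at_top"
    using assms unfolding slowly_varying_def by (blast intro: zero_less_one)
  then have "\<forall>\<^sub>F x in at_top. f (1 * x) / f x > 0"
    by (rule order_tendstoD) simp
  then show ?thesis
    using eventually_gt_at_top[of 0]
  proof eventually_elim
    case (elim x)
    then have "0 \<le> f x"
      using assms by (auto simp: slowly_varying_def nonneg_measurable_def)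
    moreover have "f x \<noteq> 0"
      using elim by auto
    ultimately show ?case
      by simp
  qed
qed

lemma slowly_varying_ratio:
  assumes f: "f \<in> slowly_varying" and d: "d > 1" and c: "c > 0"
  shows "\<forall>\<^sub>F x in at_top. f (c * x) \<le> d * f x \<and> f x \<le> d * f (c * x)"
proof -
  have lim: "((\<lambda>x. f (c * x) / f x) \<longlongrightarrow> 1) at_top"
    using f c unfolding slowly_varying_def by auto
  have "\<forall>\<^sub>F x in at_top. f (c * x) / f x < d" "\<forall>\<^sub>F x in at_top. 1 / d < f (c * x) / f x"
    using order_tendstoD[OF lim] d by auto
  then show ?thesis
    using slowly_varying_pos[OF f]
    by eventually_elim (use d in \<open>auto simp: field_simps\<close>)
qed

lemma slowly_varying_uniform:
  assumes f: "f \<in> slowly_varying" and d: "d > 1"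
  shows "\<forall>\<^sub>F x in at_top. \<forall>\<mu>\<in>{1..2}. f (\<mu> * x) \<le> d * f x \<and> f x \<le> d * f (\<mu> * x)"
proof -
  have meas: "f \<in> borel_measurable (lebesgue_on {0<..})"
    using f by (simp add: slowly_varying_def nonneg_measurable_def)
  \<comment> \<open>Two comparisons are chained through \<open>c * x\<close>, each costing
    \<open>sqrt d\<close>. Here \<open>n\<close> acts only as a threshold for
    \<open>x\<close>.\<close>
  define P where "P n x c \<longleftrightarrow> f (c * x) \<le> sqrt d * f x \<and> f x \<le> sqrt d * f (c * x)"
    for n :: nat and x c
  have "\<exists>n. \<forall>x\<ge>real n. \<forall>\<mu>\<in>{1..2}. \<exists>c\<ge>\<mu>. P n x c \<and> P n (\<mu> * x) (c / \<mu>)"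
  proof (rule uniform_dilation)
    fix n and x :: real assume "x > 0"
    note [measurable] = measurable_dilation[OF meas this]
    show "{c \<in> {1..8}. \<not> P n x c} \<in> sets lebesgue"
      unfolding P_def by (intro sets_lebesgue_of_pred) measurable
  next
    fix c :: real assume "c \<in> {1..8}"
    then obtain X where X: "\<And>x n. x \<ge> X \<Longrightarrow> P n x c"
      using slowly_varying_ratio[OF f, of "sqrt d" c] d
      by (auto simp: eventually_at_top_linorder P_def)
    then show "\<exists>N. \<forall>n\<ge>N. \<forall>x\<ge>real N. P n x c"
      using real_arch_simple[of X] by (meson order_trans)
  qed
  then obtain n where n: "\<And>x \<mu>. x \<ge> real n \<Longrightarrow> \<mu> \<in> {1..2} \<Longrightarrow> \<exists>c\<ge>\<mu>. P n x c \<and> P n (\<mu> * x) (c / \<mu>)"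
    by blast
  show ?thesis
    using eventually_ge_at_top[of "real n"]
  proof eventually_elim
    case (elim x)
    show ?case
    proof
      fix \<mu> :: real assume \<mu>: "\<mu> \<in> {1..2}"
      then obtain c where "P n x c" "P n (\<mu> * x) (c / \<mu>)"
        using n[OF elim] by blast
      moreover have "c / \<mu> * (\<mu> * x) = c * x"
        using \<mu> by simp
      ultimately have *: "f (c * x) \<le> sqrt d * f x" "f x \<le> sqrt d * f (c * x)"
        "f (c * x) \<le> sqrt d * f (\<mu> * x)" "f (\<mu> * x) \<le> sqrt d * f (c * x)"
        unfolding P_def by metis+
      have d2: "sqrt d * (sqrt d * y) = d * y" for y
        using d by (simp flip: mult.assoc)
      have "sqrt d \<ge> 0"
        using d by simp
      then show "f (\<mu> * x) \<le> d * f x \<and> f x \<le> d * f (\<mu> * x)"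
        using order_trans[OF *(4) mult_left_mono[OF *(1)]]
          order_trans[OF *(2) mult_left_mono[OF *(3)]] by (simp add: d2)
    qed
  qed
qed

lemma slowly_varying_potter:
  assumes f: "f \<in> slowly_varying" and \<epsilon>: "\<epsilon> > 0"
  shows "\<exists>C>0. \<forall>\<^sub>F x in at_top. \<forall>c\<ge>1. f (c * x) \<le> C * c powr \<epsilon> * f x \<and> f x \<le> C * c powr \<epsilon> * f (c * x)"
proof -
  \<comment> \<open>One doubling costs a factor \<open>d\<close>, which is exactly the growth of
    \<open>c powr \<epsilon>\<close> under doubling; the extra \<open>d\<close> in front pays for
    the initial factor in \<open>{1..2}\<close>.\<close>
  define d :: real where "d = 2 powr \<epsilon>"
  have d: "d > 1"
    using \<epsilon> by (simp add: d_def)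
  obtain X where X: "\<And>x \<mu>. x \<ge> X \<Longrightarrow> \<mu> \<in> {1..2} \<Longrightarrow> f (\<mu> * x) \<le> d * f x \<and> f x \<le> d * f (\<mu> * x)"
    using slowly_varying_uniform[OF f d] unfolding eventually_at_top_linorder by blast
  have *: "f (c * x) \<le> d * c powr \<epsilon> * f x \<and> f x \<le> d * c powr \<epsilon> * f (c * x)"
    if x: "x \<ge> X" "x > 0" and c: "c \<ge> 1" for x c
    using c
  proof (induction c rule: dyadic_induct)
    fix c :: real assume c: "c \<in> {1..2}"
    have nn: "f x \<ge> 0" "f (c * x) \<ge> 0"
      using f x c by (auto simp: slowly_varying_def nonneg_measurable_def)
    have "d * 1 \<le> d * c powr \<epsilon>"
      using c d \<epsilon> by (intro mult_left_mono ge_one_powr_ge_zero) auto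
    then have "d * f x \<le> d * c powr \<epsilon> * f x" "d * f (c * x) \<le> d * c powr \<epsilon> * f (c * x)"
      using nn by (auto intro!: mult_right_mono)
    then show "f (c * x) \<le> d * c powr \<epsilon> * f x \<and> f x \<le> d * c powr \<epsilon> * f (c * x)"
      using X[OF x(1) c] by linarith
  next
    fix c :: real
    assume c: "c \<ge> 1" and IH: "f (c * x) \<le> d * c powr \<epsilon> * f x \<and> f x \<le> d * c powr \<epsilon> * f (c * x)"
    have "1 * x \<le> c * x"
      using c x by (intro mult_right_mono) auto
    then have "X \<le> c * x"
      using x by linarith
    then have 2: "f (2 * c * x) \<le> d * f (c * x)" "f (c * x) \<le> d * f (2 * c * x)"
      using X[of "c * x" 2] by (auto simp: mult.assoc)
    have p: "(2 * c) powr \<epsilon> = d * c powr \<epsilon>"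
      using c by (simp add: powr_mult d_def)
    have "d * f (c * x) \<le> d * (d * c powr \<epsilon> * f x)"
      using IH d by (intro mult_left_mono) auto
    moreover have "d * c powr \<epsilon> * f (c * x) \<le> d * c powr \<epsilon> * (d * f (2 * c * x))"
      using 2 d by (intro mult_left_mono) auto
    ultimately show "f (2 * c * x) \<le> d * (2 * c) powr \<epsilon> * f x \<and> f x \<le> d * (2 * c) powr \<epsilon> * f (2 * c * x)"
      using 2 IH unfolding p by (auto simp: mult_ac intro: order_trans)
  qed
  show ?thesis
  proof (intro exI conjI)
    show "\<forall>\<^sub>F x in at_top. \<forall>c\<ge>1. f (c * x) \<le> d * c powr \<epsilon> * f x \<and> f x \<le> d * c powr \<epsilon> * f (c * x)"
      using eventually_ge_at_top[of X] eventually_gt_at_top[of 0] by eventually_elim (use * in blast)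
  qed (use d in auto)
qed

lemma slowly_varying_mult:
  assumes "f \<in> slowly_varying" "g \<in> slowly_varying"
  shows "(\<lambda>x. f x * g x) \<in> slowly_varying"
proof -
  have "((\<lambda>x. f (c * x) * g (c * x) / (f x * g x)) \<longlongrightarrow> 1) at_top" if "c > 0" for c
  proof -
    have "((\<lambda>x. (f (c * x) / f x) * (g (c * x) / g x)) \<longlongrightarrow> 1 * 1) at_top"
      using assms that by (intro tendsto_mult) (auto simp: slowly_varying_def)
    then show ?thesis
      by simp
  qed
  then show ?thesis
    using assms by (auto simp: slowly_varying_def nonneg_measurable_def)
qed

section \<open>Slow variation with remainder\<close>

text \<open>The remainder condition speaks of factors above 1 only. A factor \<open>c < 1\<close> is
  reached by evaluating the limit for \<open>inverse c\<close> at \<open>c * x\<close> and taking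
  reciprocals.\<close>

lemma slowly_varying_rem_imp_slowly_varying:
  assumes l: "l \<in> slowly_varying_rem g"
  shows "l \<in> slowly_varying"
proof -
  have gt1: "((\<lambda>x. l (c * x) / l x) \<longlongrightarrow> 1) at_top" if "c > 1" for c
  proof -
    have "(\<lambda>x. l (c * x) / l x - 1) \<in> O[at_top](g)"
      using l that by (auto simp: slowly_varying_rem_def)
    moreover have "(g \<longlongrightarrow> 0) at_top"
      using l by (auto simp: slowly_varying_rem_def)
    ultimately have "((\<lambda>x. l (c * x) / l x - 1) \<longlongrightarrow> 0) at_top"
      using landau_o.big_small_trans smalloI_tendsto[of g "\<lambda>_. 1"] smalloD_tendsto by fastforce
    then show ?thesis
      by (simp add: LIM_zero_iff)
  qed
  have "((\<lambda>x. l (c * x) / l x) \<longlongrightarrow> 1) at_top" if c: "c > 0" for c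
  proof (cases c "1::real" rule: linorder_cases)
    case less
    have "((\<lambda>x. l (inverse c * (c * x)) / l (c * x)) \<longlongrightarrow> 1) at_top"
    proof (rule filterlim_compose[OF gt1[of "inverse c"]])
      show "filterlim ((*) c) at_top at_top"
        using c by (rule filterlim_tendsto_pos_mult_at_top[OF tendsto_const _ filterlim_ident])
    qed (use less c in \<open>auto simp: one_less_inverse\<close>)
    then have "((\<lambda>x. inverse (l (inverse c * (c * x)) / l (c * x))) \<longlongrightarrow> inverse 1) at_top"
      by (rule tendsto_inverse) simp
    then show ?thesis
      using c by (simp flip: mult.assoc)
  next
    \<comment> \<open>For factor 1 only \<open>l x \<noteq> 0\<close> matters, and a positive
      quotient with any other factor, here 2, shows it.\<close>
    case equal
    have "\<forall>\<^sub>F x in at_top. l (2 * x) / l x > 0"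
      using order_tendstoD(1)[OF gt1[of 2], of 0] by simp
    then have "\<forall>\<^sub>F x in at_top. l (c * x) / l x = 1"
      by eventually_elim (auto simp: equal)
    then show ?thesis
      by (rule tendsto_eventually)
  qed (rule gt1)
  then show ?thesis
    using l by (auto simp: slowly_varying_def slowly_varying_rem_def)
qed

lemma slowly_varying_rem_ratio:
  assumes l: "l \<in> slowly_varying_rem g" and c: "c \<ge> 1"
  shows "\<exists>K. \<forall>\<^sub>F x in at_top. \<bar>l (c * x) - l x\<bar> \<le> K * (g x * l x)"
proof (cases "c = 1")
  case True
  then show ?thesis
    by (intro exI[of _ 0]) simp
next
  case False
  then have "(\<lambda>x. l (c * x) / l x - 1) \<in> O[at_top](g)"
    using l c by (auto simp: slowly_varying_rem_def)
  then obtain K where "\<forall>\<^sub>F x in at_top. norm (l (c * x) / l x - 1) \<le> K * norm (g x)"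
    by (elim landau_o.bigE)
  then have "\<forall>\<^sub>F x in at_top. \<bar>l (c * x) - l x\<bar> \<le> K * (g x * l x)"
    using slowly_varying_pos[OF slowly_varying_rem_imp_slowly_varying[OF l]] eventually_gt_at_top[of 0]
  proof eventually_elim
    case (elim x)
    have g: "g x \<ge> 0"
      using l elim by (auto simp: slowly_varying_rem_def nonneg_measurable_def)
    have "\<bar>l (c * x) - l x\<bar> = \<bar>l (c * x) / l x - 1\<bar> * l x"
      using elim by (simp add: abs_if field_simps)
    also have "\<dots> \<le> K * g x * l x"
      using elim g by (intro mult_right_mono) auto
    finally show ?case
      by (simp add: mult_ac)
  qed
  then show ?thesis ..
qed

lemma slowly_varying_rem_uniform:
  assumes l: "l \<in> slowly_varying_rem g" and g: "g \<in> slowly_varying"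
  shows "\<exists>C>0. \<forall>\<^sub>F x in at_top. \<forall>\<mu>\<in>{1..2}. \<bar>l (\<mu> * x) - l x\<bar> \<le> C * (g x * l x)"
proof -
  define m where "m x = g x * l x" for x
  have m: "m \<in> slowly_varying"
    using slowly_varying_mult[OF g slowly_varying_rem_imp_slowly_varying[OF l]] by (simp add: m_def[abs_def])
  have m0: "m x \<ge> 0" if "x > 0" for x
    using m that by (auto simp: slowly_varying_def nonneg_measurable_def)
  have meas: "l \<in> borel_measurable (lebesgue_on {0<..})"
    using l by (simp add: slowly_varying_rem_def nonneg_measurable_def)
  \<comment> \<open>The index \<open>n\<close> is also the constant of the estimate, since the
    constant \<open>K\<close> for a single factor depends on that factor.\<close>
  define P where "P n x c \<longleftrightarrow> \<bar>l (c * x) - l x\<bar> \<le> real n * m x" for n :: nat and x c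
  have "\<exists>n. \<forall>x\<ge>real n. \<forall>\<mu>\<in>{1..2}. \<exists>c\<ge>\<mu>. P n x c \<and> P n (\<mu> * x) (c / \<mu>)"
  proof (rule uniform_dilation)
    fix n and x :: real assume "x > 0"
    note [measurable] = measurable_dilation[OF meas this]
    show "{c \<in> {1..8}. \<not> P n x c} \<in> sets lebesgue"
      unfolding P_def by (intro sets_lebesgue_of_pred) measurable
  next
    fix c :: real assume "c \<in> {1..8}"
    then obtain K X where X: "\<And>x. x \<ge> X \<Longrightarrow> \<bar>l (c * x) - l x\<bar> \<le> K * m x"
      using slowly_varying_rem_ratio[OF l, of c]
      by (auto simp: eventually_at_top_linorder m_def)
    \<comment> \<open>\<open>N\<close> dominates the threshold \<open>X\<close> and the constant
      \<open>K\<close>; being at least 1 it also forces \<open>x > 0\<close>, hence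
      \<open>m x \<ge> 0\<close>, which enlarging \<open>K\<close> to \<open>n\<close>
      requires.\<close>
    obtain N where N: "real N \<ge> max 1 (max X K)"
      using real_arch_simple by blast
    have "P n x c" if "n \<ge> N" "x \<ge> real N" for n x
    proof -
      have "K * m x \<le> real n * m x"
        using that N by (intro mult_right_mono m0) auto
      then show ?thesis
        using X[of x] that N unfolding P_def by auto
    qed
    then show "\<exists>N. \<forall>n\<ge>N. \<forall>x\<ge>real N. P n x c"
      by blast
  qed
  then obtain n where n: "\<And>x \<mu>. x \<ge> real n \<Longrightarrow> \<mu> \<in> {1..2} \<Longrightarrow> \<exists>c\<ge>\<mu>. P n x c \<and> P n (\<mu> * x) (c / \<mu>)"
    by blast
  have "\<forall>\<^sub>F x in at_top. \<forall>\<mu>\<in>{1..2}. m (\<mu> * x) \<le> 2 * m x \<and> m x \<le> 2 * m (\<mu> * x)"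
    by (rule slowly_varying_uniform[OF m]) simp
  then have "\<forall>\<^sub>F x in at_top. \<forall>\<mu>\<in>{1..2}. \<bar>l (\<mu> * x) - l x\<bar> \<le> (3 * real n + 1) * m x"
    using eventually_ge_at_top[of "real n"] eventually_gt_at_top[of 0]
  proof eventually_elim
    case (elim x)
    show ?case
    proof
      fix \<mu> :: real assume \<mu>: "\<mu> \<in> {1..2}"
      then obtain c where "P n x c" "P n (\<mu> * x) (c / \<mu>)"
        using n[OF elim(2)] by blast
      moreover have "c / \<mu> * (\<mu> * x) = c * x"
        using \<mu> by simp
      ultimately have "\<bar>l (c * x) - l x\<bar> \<le> real n * m x" "\<bar>l (c * x) - l (\<mu> * x)\<bar> \<le> real n * m (\<mu> * x)"
        unfolding P_def by metis+
      moreover have "real n * m (\<mu> * x) \<le> real n * (2 * m x)"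
        using elim \<mu> by (intro mult_left_mono) auto
      \<comment> \<open>One \<open>n\<close> comes from the base point \<open>x\<close> and two from
        \<open>\<mu> * x\<close>, where \<open>m\<close> is at most twice \<open>m x\<close>. The
        \<open>+ 1\<close> in the final constant only keeps it positive when
        \<open>n = 0\<close>.\<close>
      ultimately have "\<bar>l (\<mu> * x) - l x\<bar> \<le> 3 * (real n * m x)"
        by linarith
      then show "\<bar>l (\<mu> * x) - l x\<bar> \<le> (3 * real n + 1) * m x"
        using m0[OF elim(3)] by (simp add: algebra_simps)
    qed
  qed
  then show ?thesis
    unfolding m_def by (intro exI[of _ "3 * real n + 1"]) auto
qed

text \<open>The difference telescopes over doublings. The step from \<open>c * x\<close> to
  \<open>2 * c * x\<close> is controlled by \<open>m (c * x)\<close>, and Potter for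
  \<open>m\<close> brings this back to \<open>m x\<close> at the price
  \<open>c powr \<epsilon>\<close>. These prices grow geometrically, so their sum is comparable with
  the last one.\<close>

lemma slowly_varying_rem_global:
  assumes l: "l \<in> slowly_varying_rem g" and g: "g \<in> slowly_varying" and \<epsilon>: "\<epsilon> > 0"
  shows "\<exists>C>0. \<forall>\<^sub>F x in at_top. \<forall>c\<ge>1. \<bar>l (c * x) - l x\<bar> \<le> C * c powr \<epsilon> * (g x * l x)"
proof -
  define m where "m x = g x * l x" for x
  have m: "m \<in> slowly_varying"
    using slowly_varying_mult[OF g slowly_varying_rem_imp_slowly_varying[OF l]] by (simp add: m_def[abs_def])
  have m0: "m x \<ge> 0" if "x > 0" for x
    using m that by (auto simp: slowly_varying_def nonneg_measurable_def)
  obtain C where C: "C > 0" "\<forall>\<^sub>F x in at_top. \<forall>\<mu>\<in>{1..2}. \<bar>l (\<mu> * x) - l x\<bar> \<le> C * m x"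
    using slowly_varying_rem_uniform[OF l g] unfolding m_def by blast
  obtain C' where C': "C' > 0"
    "\<forall>\<^sub>F x in at_top. \<forall>c\<ge>1. m (c * x) \<le> C' * c powr \<epsilon> * m x \<and> m x \<le> C' * c powr \<epsilon> * m (c * x)"
    using slowly_varying_potter[OF m \<epsilon>] by blast
  from C(2) obtain X where X: "\<And>x \<mu>. x \<ge> X \<Longrightarrow> \<mu> \<in> {1..2} \<Longrightarrow> \<bar>l (\<mu> * x) - l x\<bar> \<le> C * m x"
    unfolding eventually_at_top_linorder by blast
  from C'(2) obtain X' where X': "\<And>x c. x \<ge> X' \<Longrightarrow> c \<ge> 1 \<Longrightarrow> m (c * x) \<le> C' * c powr \<epsilon> * m x"
    unfolding eventually_at_top_linorder by blast
  define d :: real where "d = 2 powr \<epsilon>"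
  have d: "d > 1"
    using \<epsilon> by (simp add: d_def)
  \<comment> \<open>chosen so that \<open>C * C' + D \<le> D * d\<close>, which absorbs one more dyadic step\<close>
  define D where "D = C + C * C' / (d - 1)"
  have D: "D > 0" "D \<ge> C"
    using C(1) C'(1) d by (auto simp: D_def add_pos_pos)
  have CD: "C * C' + D \<le> D * d"
  proof -
    have "D * (d - 1) = C * (d - 1) + C * C'"
      using d by (simp add: D_def distrib_right)
    moreover have "C * (d - 1) > 0"
      using C(1) d by simp
    ultimately show ?thesis
      by (simp add: algebra_simps)
  qed
  have *: "\<bar>l (c * x) - l x\<bar> \<le> D * c powr \<epsilon> * m x"
    if x: "x \<ge> X" "x \<ge> X'" "x > 0" and c: "c \<ge> 1" for x c
    using c
  proof (induction c rule: dyadic_induct)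
    fix c :: real assume c: "c \<in> {1..2}"
    have "C * 1 \<le> D * c powr \<epsilon>"
      using c C(1) D \<epsilon> by (intro mult_mono ge_one_powr_ge_zero) auto
    then have "C * m x \<le> D * c powr \<epsilon> * m x"
      using m0[OF x(3)] by (intro mult_right_mono) auto
    then show "\<bar>l (c * x) - l x\<bar> \<le> D * c powr \<epsilon> * m x"
      using X[OF x(1) c] by linarith
  next
    fix c :: real
    assume c: "c \<ge> 1" and IH: "\<bar>l (c * x) - l x\<bar> \<le> D * c powr \<epsilon> * m x"
    have "1 * x \<le> c * x"
      using c x by (intro mult_right_mono) auto
    then have "X \<le> c * x"
      using x by linarith
    then have "\<bar>l (2 * c * x) - l (c * x)\<bar> \<le> C * m (c * x)"
      using X[of "c * x" 2] by (auto simp: mult.assoc)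
    also have "\<dots> \<le> C * (C' * c powr \<epsilon> * m x)"
      using X'[OF x(2) c] C(1) by (intro mult_left_mono) auto
    finally have "\<bar>l (2 * c * x) - l x\<bar> \<le> (C * C' + D) * (c powr \<epsilon> * m x)"
      using IH by (simp add: algebra_simps)
    also have "\<dots> \<le> (D * d) * (c powr \<epsilon> * m x)"
      using CD m0[OF x(3)] by (intro mult_right_mono) auto
    also have "\<dots> = D * (2 * c) powr \<epsilon> * m x"
      using c by (simp add: powr_mult d_def)
    finally show "\<bar>l (2 * c * x) - l x\<bar> \<le> D * (2 * c) powr \<epsilon> * m x" .
  qed
  show ?thesis
  proof (intro exI conjI)
    show "\<forall>\<^sub>F x in at_top. \<forall>c\<ge>1. \<bar>l (c * x) - l x\<bar> \<le> D * c powr \<epsilon> * (g x * l x)"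
      using eventually_ge_at_top[of X] eventually_ge_at_top[of X'] eventually_gt_at_top[of 0]
      by eventually_elim (use * in \<open>auto simp: m_def\<close>)
  qed (use D in auto)
qed

section \<open>Bounds for two arbitrary large arguments\<close>

text \<open>Stands for the Potter factor max(y/x, x/y)^\<epsilon> up to a factor 2. With the sum in
  place of the maximum no case distinction is left: for \<open>y = x / s\<close> it is just
  \<open>s powr (-\<epsilon>) + s powr \<epsilon>\<close>.\<close>

definition spread :: "real \<Rightarrow> real \<Rightarrow> real \<Rightarrow> real" where
  "spread \<epsilon> x y = (y / x) powr \<epsilon> + (x / y) powr \<epsilon>"

lemma spread_nonneg [simp]: "spread \<epsilon> x y \<ge> 0"
  by (simp add: spread_def)

lemma powr_le_spread: "(y / x) powr \<epsilon> \<le> spread \<epsilon> x y" "(x / y) powr \<epsilon> \<le> spread \<epsilon> x y"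
  by (simp_all add: spread_def)

lemma slowly_varying_spread:
  assumes f: "f \<in> slowly_varying" and \<epsilon>: "\<epsilon> > 0"
  shows "\<exists>C>0. \<forall>\<^sub>F X in at_top. \<forall>x\<ge>X. \<forall>y\<ge>X. f y \<le> C * spread \<epsilon> x y * f x"
proof -
  obtain C X where C: "C > 0" and
    X: "\<And>x c. x \<ge> X \<Longrightarrow> c \<ge> 1 \<Longrightarrow> f (c * x) \<le> C * c powr \<epsilon> * f x \<and> f x \<le> C * c powr \<epsilon> * f (c * x)"
    using slowly_varying_potter[OF f \<epsilon>] unfolding eventually_at_top_linorder by blast
  have *: "f y \<le> C * spread \<epsilon> x y * f x" if xy: "x \<ge> X" "y \<ge> X" "x > 0" "y > 0" for x y
  proof -
    have f0: "f x \<ge> 0"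
      using f xy by (auto simp: slowly_varying_def nonneg_measurable_def)
    have "f y \<le> C * (y / x) powr \<epsilon> * f x \<or> f y \<le> C * (x / y) powr \<epsilon> * f x"
    proof (cases "x \<le> y")
      case True
      then show ?thesis
        using X[of x "y / x"] xy by auto
    next
      case False
      then show ?thesis
        using X[of y "x / y"] xy by auto
    qed
    moreover have "C * (y / x) powr \<epsilon> * f x \<le> C * spread \<epsilon> x y * f x"
      "C * (x / y) powr \<epsilon> * f x \<le> C * spread \<epsilon> x y * f x"
      using C f0 by (auto intro!: mult_right_mono mult_left_mono powr_le_spread)
    ultimately show ?thesis
      by linarith
  qed
  show ?thesis
  proof (intro exI conjI)
    show "\<forall>\<^sub>F X in at_top. \<forall>x\<ge>X. \<forall>y\<ge>X. f y \<le> C * spread \<epsilon> x y * f x"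
      using eventually_ge_at_top[of X] eventually_gt_at_top[of 0]
      by eventually_elim (use * in auto)
  qed (use C in auto)
qed

text \<open>The bound must be anchored at \<open>x\<close> even when \<open>y\<close> is the smaller
  argument, whereas the one-sided estimate is anchored at the smaller one. Moving the anchor costs a
  second Potter factor, so both are taken with exponent \<open>\<epsilon> / 2\<close>.\<close>

lemma slowly_varying_rem_spread:
  assumes l: "l \<in> slowly_varying_rem g" and g: "g \<in> slowly_varying" and \<epsilon>: "\<epsilon> > 0"
  shows "\<exists>C>0. \<forall>\<^sub>F X in at_top. \<forall>x\<ge>X. \<forall>y\<ge>X. \<bar>l y - l x\<bar> \<le> C * spread \<epsilon> x y * (g x * l x)"
proof -
  define m where "m x = g x * l x" for x
  have m: "m \<in> slowly_varying"
    using slowly_varying_mult[OF g slowly_varying_rem_imp_slowly_varying[OF l]] by (simp add: m_def[abs_def])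
  have m0: "m x \<ge> 0" if "x > 0" for x
    using m that by (auto simp: slowly_varying_def nonneg_measurable_def)
  obtain C X where C: "C > 0" and
    X: "\<And>x c. x \<ge> X \<Longrightarrow> c \<ge> 1 \<Longrightarrow> \<bar>l (c * x) - l x\<bar> \<le> C * c powr (\<epsilon> / 2) * m x"
    using slowly_varying_rem_global[OF l g half_gt_zero[OF \<epsilon>]]
    unfolding eventually_at_top_linorder m_def by blast
  obtain C' X' where C': "C' > 0" and
    X': "\<And>x c. x \<ge> X' \<Longrightarrow> c \<ge> 1 \<Longrightarrow> m x \<le> C' * c powr (\<epsilon> / 2) * m (c * x)"
    using slowly_varying_potter[OF m half_gt_zero[OF \<epsilon>]]
    unfolding eventually_at_top_linorder by blast
  define D where "D = max C (C * C')"
  have D: "D > 0"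
    using C C' by (simp add: D_def)
  have *: "\<bar>l y - l x\<bar> \<le> D * spread \<epsilon> x y * m x"
    if xy: "x \<ge> max X X'" "y \<ge> max X X'" "x > 0" "y > 0" for x y
  proof (cases "x \<le> y")
    case True
    have "(y / x) powr (\<epsilon> / 2) \<le> (y / x) powr \<epsilon>"
      using True xy \<epsilon> by (intro powr_mono) auto
    then have "C * (y / x) powr (\<epsilon> / 2) \<le> D * spread \<epsilon> x y"
      using C by (intro mult_mono order_trans[OF _ powr_le_spread(1)]) (auto simp: D_def)
    then have "C * (y / x) powr (\<epsilon> / 2) * m x \<le> D * spread \<epsilon> x y * m x"
      using m0 xy by (intro mult_right_mono) auto
    then show ?thesis
      using X[of x "y / x"] True xy by auto
  next
    case False
    define t where "t = x / y"
    have t: "t \<ge> 1" "t * y = x"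
      using False xy by (auto simp: t_def)
    have "\<bar>l y - l x\<bar> \<le> C * t powr (\<epsilon> / 2) * m y"
      using X[of y t] t xy by (auto simp: abs_minus_commute)
    also have "\<dots> \<le> C * t powr (\<epsilon> / 2) * (C' * t powr (\<epsilon> / 2) * m x)"
      using X'[of y t] t xy C by (intro mult_left_mono) auto
    also have "\<dots> = C * C' * (t powr (\<epsilon> / 2) * t powr (\<epsilon> / 2)) * m x"
      by simp
    also have "t powr (\<epsilon> / 2) * t powr (\<epsilon> / 2) = t powr \<epsilon>"
      by (simp flip: powr_add)
    also have "C * C' * t powr \<epsilon> * m x \<le> D * spread \<epsilon> x y * m x"
      using D m0[of x] xy unfolding t_def
      by (intro mult_right_mono mult_mono powr_le_spread) (auto simp: D_def)
    finally show ?thesis .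
  qed
  show ?thesis
  proof (intro exI conjI)
    show "\<forall>\<^sub>F X in at_top. \<forall>x\<ge>X. \<forall>y\<ge>X. \<bar>l y - l x\<bar> \<le> D * spread \<epsilon> x y * (g x * l x)"
      using eventually_ge_at_top[of "max X X'"] eventually_gt_at_top[of 0]
      by eventually_elim (use * in \<open>auto simp: m_def\<close>)
  qed (use D in auto)
qed

text \<open>The two Zygmund monotonicity conditions are Potter bounds with constant 1: the
  decreasing function serves \<open>x \<le> y\<close>, the increasing one
  \<open>y < x\<close>.\<close>

lemma zygmund_spread:
  assumes h: "h \<in> zygmund" and \<epsilon>: "\<epsilon> > 0"
  shows "\<forall>\<^sub>F X in at_top. \<forall>x\<ge>X. \<forall>y\<ge>X. h y \<le> spread \<epsilon> x y * h x"
proof -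
  have "\<exists>X>0. mono_on {X<..} (\<lambda>x. x powr \<epsilon> * h x)" "\<exists>X>0. antimono_on {X<..} (\<lambda>x. x powr (-\<epsilon>) * h x)"
    using h \<epsilon> by (auto simp: zygmund_def)
  then obtain X X' where X: "X > 0" "mono_on {X<..} (\<lambda>x. x powr \<epsilon> * h x)"
    and X': "X' > 0" "antimono_on {X'<..} (\<lambda>x. x powr (-\<epsilon>) * h x)"
    by blast
  have *: "h y \<le> spread \<epsilon> x y * h x" if xy: "x > max X X'" "y > max X X'" for x y
  proof -
    have pos: "x > 0" "y > 0"
      using xy X by auto
    have h0: "h x \<ge> 0"
      using h pos by (auto simp: zygmund_def nonneg_measurable_def)
    have "h y \<le> (y / x) powr \<epsilon> * h x \<or> h y \<le> (x / y) powr \<epsilon> * h x"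
    proof (cases "x \<le> y")
      case True
      then have "y powr (-\<epsilon>) * h y \<le> x powr (-\<epsilon>) * h x"
        using xy by (intro monotone_onD[OF X'(2)]) auto
      then show ?thesis
        using pos by (simp add: powr_minus powr_divide field_simps)
    next
      case False
      then have "y powr \<epsilon> * h y \<le> x powr \<epsilon> * h x"
        using xy by (intro monotone_onD[OF X(2)]) auto
      then show ?thesis
        using pos by (simp add: powr_divide field_simps)
    qed
    moreover have "(y / x) powr \<epsilon> * h x \<le> spread \<epsilon> x y * h x" "(x / y) powr \<epsilon> * h x \<le> spread \<epsilon> x y * h x"
      using h0 by (auto intro!: mult_right_mono powr_le_spread)
    ultimately show ?thesis
      by linarith
  qed
  show ?thesis
    using eventually_gt_at_top[of "max X X'"] by eventually_elim (use * in auto)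
qed

section \<open>Splitting of errors and elementary bounds\<close>

text \<open>\<open>r\<close> is divided in proportion to \<open>g\<close> and \<open>h\<close>.
  Where \<open>g + h\<close> vanishes, the O-bound makes \<open>r\<close> vanish too, so the
  convention for division by zero gives the right value 0.\<close>

lemma bigo_add_decompose:
  fixes r g h :: "real \<Rightarrow> real"
  assumes r: "r \<in> O[F](\<lambda>x. g x + h x)"
    and g: "\<forall>\<^sub>F x in F. 0 \<le> g x" and h: "\<forall>\<^sub>F x in F. 0 \<le> h x"
  shows "\<exists>a\<in>O[F](g). \<exists>b\<in>O[F](h). \<forall>\<^sub>F x in F. r x = a x + b x"
proof -
  obtain C where C: "\<forall>\<^sub>F x in F. norm (r x) \<le> C * norm (g x + h x)"
    using r by (elim landau_o.bigE)
  have r: "\<forall>\<^sub>F x in F. \<bar>r x\<bar> \<le> C * (g x + h x) \<and> 0 \<le> g x \<and> 0 \<le> h x"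
    using C g h by eventually_elim auto
  have *: "\<bar>r * u / s\<bar> \<le> C * u" if "\<bar>r\<bar> \<le> C * s" "0 \<le> u" "u \<le> s" for r s u :: real
  proof (cases "s = 0")
    case False
    then have "\<bar>r\<bar> * u / s \<le> C * s * u / s"
      using that by (intro divide_right_mono mult_right_mono) auto
    then show ?thesis
      using that False by (simp add: abs_mult)
  qed (use that in auto)
  show ?thesis
  proof (intro bexI)
    show "\<forall>\<^sub>F x in F. r x = r x * g x / (g x + h x) + r x * h x / (g x + h x)"
      using r by eventually_elim (auto simp: add_nonneg_eq_0_iff simp flip: add_divide_distrib distrib_left)
    show "(\<lambda>x. r x * g x / (g x + h x)) \<in> O[F](g)"
    proof (rule bigoI)
      show "\<forall>\<^sub>F x in F. norm (r x * g x / (g x + h x)) \<le> C * norm (g x)"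
        using r
      proof eventually_elim
        case (elim x)
        then show ?case
          using *[of "r x" "g x + h x" "g x"] by simp
      qed
    qed
    show "(\<lambda>x. r x * h x / (g x + h x)) \<in> O[F](h)"
    proof (rule bigoI)
      show "\<forall>\<^sub>F x in F. norm (r x * h x / (g x + h x)) \<le> C * norm (h x)"
        using r
      proof eventually_elim
        case (elim x)
        then show ?case
          using *[of "r x" "g x + h x" "h x"] by simp
      qed
    qed
  qed
qed

lemma powr_le_sum_powr:
  fixes s :: real
  assumes "s > 0" "a \<le> p" "p \<le> b"
  shows "s powr p \<le> s powr a + s powr b"
proof (cases "s \<ge> 1")
  case True
  then have "s powr p \<le> s powr b"
    using assms by (intro powr_mono) auto
  then show ?thesis
    by (simp add: add_increasing)
next
  case False
  then have "s powr p \<le> s powr a"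
    using assms by (intro powr_mono') auto
  then show ?thesis
    by (simp add: add_increasing2)
qed

text \<open>This is (a + b)^2 \<le> 2 (a^2 + b^2). It merges the separate bounds for
  \<open>l\<close> and \<open>h\<close> when these are multiplied.\<close>

lemma spread_half_square:
  assumes "x > 0" "y > 0"
  shows "spread (\<epsilon> / 2) x y * spread (\<epsilon> / 2) x y \<le> 2 * spread \<epsilon> x y"
proof -
  define a b where "a = (y / x) powr (\<epsilon> / 2)" and "b = (x / y) powr (\<epsilon> / 2)"
  have "spread \<epsilon> x y = a * a + b * b"
    by (simp add: a_def b_def spread_def flip: powr_add)
  moreover have "0 \<le> (a - b) * (a - b)"
    by simp
  ultimately show ?thesis
    by (simp add: spread_def algebra_simps flip: a_def b_def)
qed

text \<open>The Potter bound is read from one fixed base point \<open>X\<close> with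
  \<open>f X > 0\<close> and factor \<open>x / X\<close>; all that depends on \<open>X\<close> goes
  into the constant.\<close>

lemma slowly_varying_lower_bound:
  assumes f: "f \<in> slowly_varying" and \<delta>: "\<delta> > 0"
  shows "\<exists>C>0. \<forall>\<^sub>F x in at_top. 1 \<le> C * (x powr \<delta> * f x)"
proof -
  obtain C where C: "C > 0" and ev: "\<forall>\<^sub>F x in at_top. \<forall>c\<ge>1. f (c * x) \<le> C * c powr \<delta> * f x \<and> f x \<le> C * c powr \<delta> * f (c * x)"
    using slowly_varying_potter[OF f \<delta>] by blast
  obtain X where X: "X > 0" "f X > 0" "\<And>c. c \<ge> 1 \<Longrightarrow> f X \<le> C * c powr \<delta> * f (c * X)"
    using eventually_happens'[OF _ eventually_conj[OF ev eventually_conj[OF slowly_varying_pos[OF f] eventually_gt_at_top[of 0]]]]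
    by auto
  define D where "D = C / (X powr \<delta> * f X)"
  have "\<forall>\<^sub>F x in at_top. 1 \<le> D * (x powr \<delta> * f x)"
    using eventually_ge_at_top[of X]
  proof eventually_elim
    case (elim x)
    then show ?case
      using X(3)[of "x / X"] X(1,2) C by (simp add: D_def powr_divide field_simps)
  qed
  moreover have "D > 0"
    using C X by (simp add: D_def)
  ultimately show ?thesis
    by blast
qed

section \<open>Comparison of \<open>f\<close> with its regularly varying model, uniformly in
  \<open>s\<close>\<close>

lemma regular_variation_uniform_bound:
  fixes f l g h e :: "real \<Rightarrow> real" and \<sigma> \<tau> \<rho> :: real
  assumes e: "e \<in> O[at_top](h)" and f: "\<forall>\<^sub>F x in at_top. f x = x powr \<rho> * l x * (1 + e x)"
    and \<rho>: "\<sigma> < \<rho>" "\<rho> < \<tau>"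
    and l: "l \<in> slowly_varying_rem g" and g: "g \<in> slowly_varying" and h: "h \<in> zygmund"
    and bd: "\<And>a. a > 0 \<Longrightarrow> bounded ((\<lambda>x. x powr (-\<sigma>) * f x) ` {0<..a})"
  shows "\<exists>C>0. \<forall>\<^sub>F x in at_top. \<forall>s>0. \<bar>f (x / s) - (x / s) powr \<rho> * l x\<bar> \<le>
    C * (s powr (-\<sigma>) + s powr (-\<tau>)) * (x powr \<rho> * l x * (g x + h x))"
proof -
  \<comment> \<open>The largest choice for which both \<open>-\<rho> - \<epsilon>\<close> and
    \<open>-\<rho> + \<epsilon>\<close> lie between \<open>-\<tau>\<close> and
    \<open>-\<sigma>\<close>.\<close>
  define \<epsilon> where "\<epsilon> = min (\<rho> - \<sigma>) (\<tau> - \<rho>)"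
  have \<epsilon>: "\<epsilon> > 0" "\<epsilon> / 2 > 0"
    using \<rho> by (auto simp: \<epsilon>_def)
  have lsv: "l \<in> slowly_varying"
    using slowly_varying_rem_imp_slowly_varying[OF l] .
  have m: "(\<lambda>x. g x * l x) \<in> slowly_varying"
    using slowly_varying_mult[OF g lsv] .
  have nn: "l x \<ge> 0" "g x \<ge> 0" "h x \<ge> 0" if "x > 0" for x
    using lsv g h that by (auto simp: slowly_varying_def zygmund_def nonneg_measurable_def)
  obtain C1 where C1: "C1 > 0"
    "\<forall>\<^sub>F X in at_top. \<forall>x\<ge>X. \<forall>y\<ge>X. \<bar>l y - l x\<bar> \<le> C1 * spread \<epsilon> x y * (g x * l x)"
    using slowly_varying_rem_spread[OF l g \<epsilon>(1)] by blast
  obtain C2 where C2: "C2 > 0"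
    "\<forall>\<^sub>F X in at_top. \<forall>x\<ge>X. \<forall>y\<ge>X. l y \<le> C2 * spread (\<epsilon> / 2) x y * l x"
    using slowly_varying_spread[OF lsv \<epsilon>(2)] by blast
  obtain K where K: "K > 0" "\<forall>\<^sub>F x in at_top. norm (e x) \<le> K * norm (h x)"
    using e by (elim landau_o.bigE)
  obtain Y where Y: "\<And>x. x \<ge> Y \<Longrightarrow> norm (e x) \<le> K * norm (h x)"
      "\<And>x. x \<ge> Y \<Longrightarrow> f x = x powr \<rho> * l x * (1 + e x)"
    using eventually_conj[OF K(2) f] unfolding eventually_at_top_linorder by blast
  obtain X where XY: "X \<ge> Y" "X > 0"
    and X1: "\<And>x y. x \<ge> X \<Longrightarrow> y \<ge> X \<Longrightarrow> \<bar>l y - l x\<bar> \<le> C1 * spread \<epsilon> x y * (g x * l x)"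
    and X2: "\<And>x y. x \<ge> X \<Longrightarrow> y \<ge> X \<Longrightarrow> l y \<le> C2 * spread (\<epsilon> / 2) x y * l x"
    and X3: "\<And>x y. x \<ge> X \<Longrightarrow> y \<ge> X \<Longrightarrow> h y \<le> spread (\<epsilon> / 2) x y * h x"
    using eventually_happens'[OF _ eventually_conj[OF eventually_ge_at_top[of Y]
      eventually_conj[OF eventually_gt_at_top[of 0] eventually_conj[OF C1(2)
      eventually_conj[OF C2(2) zygmund_spread[OF h \<epsilon>(2)]]]]]] by auto
  define W where "W s = s powr (-\<sigma>) + s powr (-\<tau>)" for s
  have W0: "W s \<ge> 0" for s
    by (simp add: W_def)
  \<comment> \<open>\<open>C1\<close> pays for \<open>l y - l x\<close> and
    \<open>2 * K * C2\<close> for \<open>l y * e y\<close>, its 2 coming from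
    \<open>spread_half_square\<close>. The outer 2 arises because each of two powers of
    \<open>s\<close> is bounded by \<open>W s\<close>.\<close>
  define D1 where "D1 = 2 * (C1 + 2 * K * C2)"
  have far: "\<bar>f (x / s) - (x / s) powr \<rho> * l x\<bar> \<le> D1 * W s * (x powr \<rho> * l x * (g x + h x))"
    if x: "x \<ge> X" and s: "s > 0" and y: "x / s \<ge> X" for x s
  proof -
    define y S where "y = x / s" and "S = spread \<epsilon> x y"
    have pos: "x > 0" "y > 0" "y \<ge> X"
      using x s y XY by (auto simp: y_def)
    note nx = nn[OF pos(1)] and ny = nn[OF pos(2)]
    have "\<bar>l y * e y\<bar> \<le> l y * (K * h y)"
      using Y(1)[of y] pos XY ny by (simp add: abs_mult mult_left_mono)
    also have "\<dots> \<le> (C2 * spread (\<epsilon> / 2) x y * l x) * (K * (spread (\<epsilon> / 2) x y * h x))"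
      using X2[OF x pos(3)] X3[OF x pos(3)] nx ny K C2 by (intro mult_mono mult_nonneg_nonneg) auto
    also have "\<dots> = K * C2 * (l x * h x) * (spread (\<epsilon> / 2) x y * spread (\<epsilon> / 2) x y)"
      by simp
    also have "\<dots> \<le> K * C2 * (l x * h x) * (2 * S)"
      unfolding S_def using spread_half_square[OF pos(1,2)] K C2 nx by (intro mult_left_mono) auto
    finally have "\<bar>l y * e y\<bar> \<le> 2 * K * C2 * (S * (l x * h x))"
      by (simp add: mult_ac)
    moreover have "\<bar>l y - l x\<bar> \<le> C1 * (S * (l x * g x))"
      using X1[OF x pos(3)] by (simp add: S_def mult_ac)
    moreover have "2 * K * C2 * (S * (l x * h x)) \<le> (C1 + 2 * K * C2) * (S * (l x * h x))"
      using C1 nx by (intro mult_right_mono) (auto simp: S_def)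
    moreover have "C1 * (S * (l x * g x)) \<le> (C1 + 2 * K * C2) * (S * (l x * g x))"
      using K C2 nx by (intro mult_right_mono) (auto simp: S_def)
    ultimately have *: "\<bar>l y - l x\<bar> + \<bar>l y * e y\<bar> \<le> (C1 + 2 * K * C2) * (S * (l x * (g x + h x)))"
      by (simp add: distrib_left)
    have "f y - y powr \<rho> * l x = y powr \<rho> * ((l y - l x) + l y * e y)"
      using Y(2)[of y] pos XY by (simp add: algebra_simps)
    then have "\<bar>f y - y powr \<rho> * l x\<bar> = y powr \<rho> * \<bar>(l y - l x) + l y * e y\<bar>"
      by (simp add: abs_mult)
    also have "\<dots> \<le> y powr \<rho> * (\<bar>l y - l x\<bar> + \<bar>l y * e y\<bar>)"
      by (intro mult_left_mono abs_triangle_ineq) auto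
    also have "\<dots> \<le> y powr \<rho> * ((C1 + 2 * K * C2) * (S * (l x * (g x + h x))))"
      using * by (intro mult_left_mono) auto
    also have "\<dots> = (C1 + 2 * K * C2) * (s powr (-\<rho>) * S) * (x powr \<rho> * l x * (g x + h x))"
      using pos s by (simp add: y_def powr_divide powr_minus field_simps)
    also have "s powr (-\<rho>) * S = s powr (-\<rho> - \<epsilon>) + s powr (-\<rho> + \<epsilon>)"
      using pos s by (simp add: S_def spread_def y_def powr_divide powr_minus powr_add powr_diff field_simps)
    finally have 1: "\<bar>f y - y powr \<rho> * l x\<bar> \<le>
      (C1 + 2 * K * C2) * (s powr (-\<rho> - \<epsilon>) + s powr (-\<rho> + \<epsilon>)) * (x powr \<rho> * l x * (g x + h x))" .
    have "s powr (-\<rho> - \<epsilon>) + s powr (-\<rho> + \<epsilon>) \<le> 2 * W s"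
    proof -
      have "-\<tau> \<le> -\<rho> - \<epsilon>" "-\<rho> - \<epsilon> \<le> -\<sigma>" "-\<tau> \<le> -\<rho> + \<epsilon>" "-\<rho> + \<epsilon> \<le> -\<sigma>"
        using \<epsilon>(1) by (auto simp: \<epsilon>_def)
      then have "s powr (-\<rho> - \<epsilon>) \<le> s powr (-\<tau>) + s powr (-\<sigma>)"
        "s powr (-\<rho> + \<epsilon>) \<le> s powr (-\<tau>) + s powr (-\<sigma>)"
        using powr_le_sum_powr[OF s] by blast+
      then show ?thesis
        by (simp add: W_def)
    qed
    then have "(C1 + 2 * K * C2) * (s powr (-\<rho> - \<epsilon>) + s powr (-\<rho> + \<epsilon>)) * (x powr \<rho> * l x * (g x + h x))
      \<le> (C1 + 2 * K * C2) * (2 * W s) * (x powr \<rho> * l x * (g x + h x))"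
      using C1(1) C2(1) K(1) nx by (intro mult_right_mono mult_left_mono) auto
    also have "\<dots> = D1 * W s * (x powr \<rho> * l x * (g x + h x))"
      by (simp add: D1_def)
    finally show ?thesis
      using 1 unfolding y_def by linarith
  qed
  obtain B where "\<forall>y\<in>{0<..X}. \<bar>y powr (-\<sigma>) * f y\<bar> \<le> B"
    using bd[OF XY(2)] unfolding bounded_iff by auto
  then have B: "\<bar>y powr (-\<sigma>) * f y\<bar> \<le> B" if "y > 0" "y \<le> X" for y
    using that by simp
  have B0: "B \<ge> 0"
    using B[of X] XY by linarith
  obtain C3 where C3: "C3 > 0" "\<forall>\<^sub>F x in at_top. 1 \<le> C3 * (x powr (\<rho> - \<sigma>) * (g x * l x))"
    using slowly_varying_lower_bound[OF m, of "\<rho> - \<sigma>"] \<rho> by auto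
  obtain C4 where C4: "C4 > 0" "\<forall>\<^sub>F x in at_top. 1 \<le> C4 * (x powr (\<rho> - \<sigma>) * g x)"
    using slowly_varying_lower_bound[OF g, of "\<rho> - \<sigma>"] \<rho> by auto
  \<comment> \<open>For bounded \<open>y\<close> the two terms are estimated separately, with no
    cancellation. The bound \<open>B * y powr \<sigma>\<close> for \<open>f y\<close> contains
    neither \<open>l x\<close> nor \<open>g x\<close>, so \<open>C3\<close> has to supply both;
    \<open>y powr \<rho> * l x\<close> lacks only \<open>g x\<close>, supplied by
    \<open>C4\<close>.\<close>
  define D2 where "D2 = B * C3 + X powr (\<rho> - \<sigma>) * C4"
  have near: "\<bar>f (x / s) - (x / s) powr \<rho> * l x\<bar> \<le> D2 * W s * (x powr \<rho> * l x * (g x + h x))"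
    if x: "x > 0" and s: "s > 0" and y: "x / s \<le> X"
      and c3: "1 \<le> C3 * (x powr (\<rho> - \<sigma>) * (g x * l x))" and c4: "1 \<le> C4 * (x powr (\<rho> - \<sigma>) * g x)"
    for x s
  proof -
    define y where "y = x / s"
    have pos: "y > 0" "y \<le> X"
      using x s y by (auto simp: y_def)
    note nx = nn[OF x]
    have ys: "y powr \<sigma> = x powr \<sigma> * s powr (-\<sigma>)"
      using x s by (simp add: y_def powr_divide powr_minus field_simps)
    have xs: "x powr \<sigma> * x powr (\<rho> - \<sigma>) = x powr \<rho>"
      by (simp flip: powr_add)
    have "\<bar>f y\<bar> = \<bar>y powr \<sigma> * (y powr (-\<sigma>) * f y)\<bar>"
      using pos by (simp add: powr_minus flip: mult.assoc)
    also have "\<dots> = y powr \<sigma> * \<bar>y powr (-\<sigma>) * f y\<bar>"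
      by (simp only: abs_mult[of "y powr \<sigma>"] abs_of_nonneg[OF powr_ge_zero])
    also have "\<dots> \<le> y powr \<sigma> * B"
      using B[OF pos] by (intro mult_left_mono) auto
    also have "\<dots> \<le> y powr \<sigma> * B * (C3 * (x powr (\<rho> - \<sigma>) * (g x * l x)))"
      using mult_left_mono[OF c3, of "y powr \<sigma> * B"] B0 by simp
    finally have 1: "\<bar>f y\<bar> \<le> (B * C3) * (s powr (-\<sigma>) * ((x powr \<sigma> * x powr (\<rho> - \<sigma>)) * l x * g x))"
      by (simp add: ys mult_ac)
    have "y powr \<rho> = y powr \<sigma> * y powr (\<rho> - \<sigma>)"
      by (simp flip: powr_add)
    also have "\<dots> \<le> y powr \<sigma> * X powr (\<rho> - \<sigma>)"
      using pos \<rho> by (intro mult_left_mono powr_mono2) auto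
    finally have "y powr \<rho> * l x \<le> y powr \<sigma> * X powr (\<rho> - \<sigma>) * l x"
      using nx by (intro mult_right_mono) auto
    also have "\<dots> \<le> y powr \<sigma> * X powr (\<rho> - \<sigma>) * l x * (C4 * (x powr (\<rho> - \<sigma>) * g x))"
      using mult_left_mono[OF c4, of "y powr \<sigma> * X powr (\<rho> - \<sigma>) * l x"] nx by simp
    finally have 2: "y powr \<rho> * l x \<le> (X powr (\<rho> - \<sigma>) * C4) * (s powr (-\<sigma>) * ((x powr \<sigma> * x powr (\<rho> - \<sigma>)) * l x * g x))"
      by (simp add: ys mult_ac)
    have "\<bar>f y - y powr \<rho> * l x\<bar> \<le> \<bar>f y\<bar> + y powr \<rho> * l x"
      using nx abs_triangle_ineq4[of "f y" "y powr \<rho> * l x"] by (simp add: abs_mult)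
    also have "\<dots> \<le> D2 * (s powr (-\<sigma>) * (x powr \<rho> * l x * g x))"
      using 1 2 unfolding xs D2_def distrib_right by linarith
    also have "\<dots> \<le> D2 * (W s * (x powr \<rho> * l x * (g x + h x)))"
      using nx B0 C3(1) C4(1) by (intro mult_left_mono mult_mono) (auto simp: W_def D2_def)
    finally show ?thesis
      by (simp add: y_def mult.assoc)
  qed
  define D where "D = max D1 D2"
  have D: "D > 0"
    using C1(1) C2(1) K(1) by (auto simp: D_def D1_def less_max_iff_disj intro!: add_pos_pos)
  have "\<forall>\<^sub>F x in at_top. \<forall>s>0. \<bar>f (x / s) - (x / s) powr \<rho> * l x\<bar> \<le> D * W s * (x powr \<rho> * l x * (g x + h x))"
    using eventually_ge_at_top[of X] C3(2) C4(2)
  proof eventually_elim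
    case (elim x)
    have x: "x > 0"
      using elim XY by simp
    have "D1 * W s * (x powr \<rho> * l x * (g x + h x)) \<le> D * W s * (x powr \<rho> * l x * (g x + h x))"
      "D2 * W s * (x powr \<rho> * l x * (g x + h x)) \<le> D * W s * (x powr \<rho> * l x * (g x + h x))" for s
      using nn[OF x] W0 by (auto simp: D_def intro!: mult_right_mono mult_nonneg_nonneg)
    then show ?case
      using far[OF elim(1)] near[OF x _ _ elim(2,3)] by (meson linear order_trans)
  qed
  then show ?thesis
    using D unfolding W_def by blast
qed

section \<open>Real form of the Mellin transform and the convolution integral\<close>

lemma mellin_of_real:
  "of_real r \<in> mellin_domain U \<longleftrightarrow> integrable (lebesgue_on {0<..}) (\<lambda>t. t powr (-r) * U t / t)"
  "mellin U (of_real r) = of_real (integral\<^sup>L (lebesgue_on {0<..}) (\<lambda>t. t powr (-r) * U t / t))"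
proof -
  have eq: "of_real t powr (- of_real r) * of_real (U t) / of_real t = complex_of_real (t powr (-r) * U t / t)"
    if "t \<in> space (lebesgue_on {0<..})" for t
    using that by (simp add: powr_of_real flip: of_real_minus)
  show "of_real r \<in> mellin_domain U \<longleftrightarrow> integrable (lebesgue_on {0<..}) (\<lambda>t. t powr (-r) * U t / t)"
    unfolding mellin_domain_def mem_Collect_eq
    by (subst Bochner_Integration.integrable_cong[OF refl eq]) (simp_all only: complex_of_real_integrable_eq)
  show "mellin U (of_real r) = of_real (integral\<^sup>L (lebesgue_on {0<..}) (\<lambda>t. t powr (-r) * U t / t))"
    unfolding mellin_def
    by (subst Bochner_Integration.integral_cong[OF refl eq]) (simp_all only: integral_complex_of_real)
qed

text \<open>The measure dt/t is invariant under \<open>t = x / s\<close>: the absolute derivative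
  \<open>x / s\<^sup>2\<close> turns \<open>1 / t\<close> into \<open>1 / s\<close>. This moves the
  dilation from \<open>U\<close> to \<open>f\<close>.\<close>

lemma mellin_conv_substitution:
  assumes x: "x > 0" and int: "integrable (lebesgue_on {0<..}) (\<lambda>s. U s * f (x / s) / s)"
  shows "mellin_conv_exists U f x"
    and "mellin_conv U f x = integral\<^sup>L (lebesgue_on {0<..}) (\<lambda>s. U s * f (x / s) / s)"
proof -
  let ?F = "\<lambda>t. U (x / t) * f t / t"
  let ?G = "\<lambda>s. U s * f (x / s) / s"
  have eq: "\<bar>- x / s\<^sup>2\<bar> * ?F (x / s) = ?G s" if "s \<in> {0<..}" for s
    using that x by (simp add: abs_mult power2_eq_square field_simps)
  have im: "(\<lambda>s. x / s) ` {0<..} = {0<..}"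
    using x by (auto simp: image_iff intro!: bexI[of _ "x / _"])
  have G: "?G absolutely_integrable_on {0<..}"
    using int by (simp add: integrable_restrict_space set_integrable_def)
  \<comment> \<open>The change of variables is an equivalence that carries a prescribed value of the
    integral; taking \<open>integral {0<..} ?G\<close> as that value makes its left side provable
    through \<open>eq\<close>.\<close>
  have "(\<lambda>s. \<bar>- x / s\<^sup>2\<bar> * ?F (x / s)) absolutely_integrable_on {0<..} \<and>
      integral {0<..} (\<lambda>s. \<bar>- x / s\<^sup>2\<bar> * ?F (x / s)) = integral {0<..} ?G
    \<longleftrightarrow> ?F absolutely_integrable_on (\<lambda>s. x / s) ` {0<..} \<and>
      integral ((\<lambda>s. x / s) ` {0<..}) ?F = integral {0<..} ?G"
  proof (rule has_absolute_integral_change_of_variables_1')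
    show "((\<lambda>s. x / s) has_field_derivative - x / s\<^sup>2) (at s within {0<..})" if "s \<in> {0<..}" for s
      using that by (auto intro!: derivative_eq_intros simp: power2_eq_square)
    show "inj_on (\<lambda>s. x / s) {0<..}"
      using x by (auto simp: inj_on_def)
  qed auto
  moreover have "(\<lambda>s. \<bar>- x / s\<^sup>2\<bar> * ?F (x / s)) absolutely_integrable_on {0<..}"
    using G eq by (subst set_integrable_cong[OF refl refl eq]) auto
  moreover have "integral {0<..} (\<lambda>s. \<bar>- x / s\<^sup>2\<bar> * ?F (x / s)) = integral {0<..} ?G"
    by (rule integral_cong[OF eq])
  ultimately have F: "?F absolutely_integrable_on {0<..}" "integral {0<..} ?F = integral {0<..} ?G"
    unfolding im by blast+
  then have F': "integrable (lebesgue_on {0<..}) ?F"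
    by (simp add: integrable_restrict_space set_integrable_def)
  then show "mellin_conv_exists U f x"
    by (simp add: mellin_conv_exists_def)
  show "mellin_conv U f x = integral\<^sup>L (lebesgue_on {0<..}) ?G"
    using F(2) lebesgue_integral_eq_integral[OF F'] lebesgue_integral_eq_integral[OF int]
    by (simp add: mellin_conv_def)
qed

text \<open>With \<open>x\<close> fixed, \<open>L\<close> and \<open>d\<close> are mere numbers,
  later \<open>l x\<close> and the size of the error. The model
  \<open>(x / s) powr \<rho> * L\<close> factors into \<open>x powr \<rho> * L\<close> times the
  Mellin kernel, so it contributes the main term exactly and only \<open>?r\<close> is
  estimated.\<close>

lemma mellin_conv_asymp_error:
  fixes U f :: "real \<Rightarrow> real" and \<sigma> \<tau> \<rho> x L d :: real
  assumes U: "U \<in> borel_measurable (lebesgue_on {0<..})" and f: "f \<in> borel_measurable (lebesgue_on {0<..})"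
    and int: "of_real \<sigma> \<in> mellin_domain U" "of_real \<tau> \<in> mellin_domain U" "of_real \<rho> \<in> mellin_domain U"
    and x: "x > 0"
    and bd: "\<And>s. s > 0 \<Longrightarrow> \<bar>f (x / s) - (x / s) powr \<rho> * L\<bar> \<le> (s powr (-\<sigma>) + s powr (-\<tau>)) * d"
  shows "mellin_conv_exists U f x"
    and "\<bar>mellin_conv U f x - x powr \<rho> * L * Re (mellin U (of_real \<rho>))\<bar> \<le>
      integral\<^sup>L (lebesgue_on {0<..}) (\<lambda>s. (s powr (-\<sigma>) + s powr (-\<tau>)) * \<bar>U s\<bar> / s) * d"
proof -
  let ?M = "lebesgue_on {0::real<..}"
  let ?w = "\<lambda>s. (s powr (-\<sigma>) + s powr (-\<tau>)) * \<bar>U s\<bar> / s"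
  let ?r = "\<lambda>s. U s * (f (x / s) - (x / s) powr \<rho> * L) / s"
  let ?p = "\<lambda>s. s powr (-\<rho>) * U s / s"
  have "integrable ?M (\<lambda>s. \<bar>s powr (-\<sigma>) * U s / s\<bar> + \<bar>s powr (-\<tau>) * U s / s\<bar>)"
    using int unfolding mellin_of_real
    by (intro Bochner_Integration.integrable_add Bochner_Integration.integrable_abs)
  also have "?this \<longleftrightarrow> integrable ?M ?w"
    by (intro Bochner_Integration.integrable_cong) (auto simp: abs_mult add_divide_distrib algebra_simps)
  finally have w: "integrable ?M ?w" .
  have p: "integrable ?M ?p"
    using int by (simp add: mellin_of_real)
  have id: "(\<lambda>s. s) \<in> borel_measurable ?M"
    by (simp add: measurable_completion measurable_restrict_space1)
  note [measurable] = U measurable_reflection[OF f x] id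
  have rw: "norm (?r s) \<le> ?w s * d" if "s > 0" for s
  proof -
    have "\<bar>U s\<bar> / s * \<bar>f (x / s) - (x / s) powr \<rho> * L\<bar> \<le> \<bar>U s\<bar> / s * ((s powr (-\<sigma>) + s powr (-\<tau>)) * d)"
      using that by (intro mult_left_mono bd) auto
    then show ?thesis
      using that by (simp add: abs_mult mult_ac)
  qed
  have wd: "integrable ?M (\<lambda>s. ?w s * d)"
    using w by (intro Bochner_Integration.integrable_mult_left)
  have r: "integrable ?M ?r"
  proof (rule Bochner_Integration.integrable_bound[OF wd])
    show "?r \<in> borel_measurable ?M"
      by measurable
    show "AE s in ?M. norm (?r s) \<le> norm (?w s * d)"
    proof (rule AE_I2)
      fix s assume "s \<in> space ?M"
      then have "norm (?r s) \<le> ?w s * d"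
        by (intro rw) simp
      also have "\<dots> \<le> norm (?w s * d)"
        by (simp only: real_norm_def abs_ge_self)
      finally show "norm (?r s) \<le> norm (?w s * d)" .
    qed
  qed
  have cp: "integrable ?M (\<lambda>s. x powr \<rho> * L * ?p s)"
    using p by (intro Bochner_Integration.integrable_mult_right)
  have eq: "U s * f (x / s) / s = ?r s + x powr \<rho> * L * ?p s" if "s \<in> space ?M" for s
    using that x by (simp add: powr_divide powr_minus field_simps)
  have int: "integrable ?M (\<lambda>s. U s * f (x / s) / s)"
    by (rule Bochner_Integration.integrable_cong[OF refl eq, THEN iffD2])
       (assumption | rule Bochner_Integration.integrable_add[OF r cp])+
  show "mellin_conv_exists U f x"
    by (rule mellin_conv_substitution[OF x int])
  have "mellin_conv U f x = integral\<^sup>L ?M (\<lambda>s. ?r s + x powr \<rho> * L * ?p s)"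
    unfolding mellin_conv_substitution(2)[OF x int] by (rule Bochner_Integration.integral_cong[OF refl eq])
  also have "\<dots> = integral\<^sup>L ?M ?r + x powr \<rho> * L * integral\<^sup>L ?M ?p"
    by (simp only: Bochner_Integration.integral_add[OF r cp] integral_mult_right_zero)
  also have "integral\<^sup>L ?M ?p = Re (mellin U (of_real \<rho>))"
    by (simp add: mellin_of_real)
  finally have "\<bar>mellin_conv U f x - x powr \<rho> * L * Re (mellin U (of_real \<rho>))\<bar> = norm (integral\<^sup>L ?M ?r)"
    by simp
  also have "\<dots> \<le> integral\<^sup>L ?M (\<lambda>s. norm (?r s))"
    by (rule integral_norm_bound)
  also have "\<dots> \<le> integral\<^sup>L ?M (\<lambda>s. ?w s * d)"
    by (rule integral_mono[OF Bochner_Integration.integrable_norm[OF r] wd]) (rule rw, simp)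
  also have "\<dots> = integral\<^sup>L ?M ?w * d"
    by (rule integral_mult_left_zero)
  finally show "\<bar>mellin_conv U f x - x powr \<rho> * L * Re (mellin U (of_real \<rho>))\<bar> \<le> integral\<^sup>L ?M ?w * d" .
qed

section \<open>The asymptotic formula for the convolution\<close>

text \<open>If the transform vanishes at \<open>\<rho>\<close>, the product form would force the
  convolution to be zero for all large \<open>x\<close>, which the estimates do not give. So the
  errors are added to the transform, and the product form follows on dividing them by its nonzero
  value.\<close>

theorem theorem8:
  fixes U f l g h :: "real \<Rightarrow> real" and \<sigma> \<tau> \<rho> x0 :: real
  assumes "U \<in> borel_measurable (lebesgue_on {0<..})"
    and "\<sigma> < \<tau>"
    and "\<And>z. \<sigma> \<le> Re z \<Longrightarrow> Re z \<le> \<tau> \<Longrightarrow> z \<in> mellin_domain U"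
    and "f \<in> borel_measurable (lebesgue_on {0<..})"
    and "\<exists>e\<in>O[at_top](h). \<forall>\<^sub>F x in at_top. f x = x powr \<rho> * l x * (1 + e x)"
    and "\<rho> \<in> {\<sigma><..<\<tau>}"
    and "l \<in> slowly_varying_rem g" and "g \<in> slowly_varying" and "h \<in> zygmund"
    and "(g \<longlongrightarrow> 0) at_top" and "(h \<longlongrightarrow> 0) at_top"
    and "x0 > 0"
    and "locally_bounded_on {x0<..} g"
    and "locally_bounded_inverse_on {x0<..} l"
    and "locally_bounded_inverse_on {x0<..} g"
    and "\<And>a. a > 0 \<Longrightarrow> bounded ((\<lambda>x. x powr (-\<sigma>) * f x) ` {0<..a})"
  shows "(\<forall>\<^sub>F x in at_top. mellin_conv_exists U f x) \<and>
    (\<exists>a\<in>O[at_top](g). \<exists>b\<in>O[at_top](h). \<forall>\<^sub>F x in at_top.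
       complex_of_real (mellin_conv U f x) =
         of_real (x powr \<rho> * l x) * (mellin U (of_real \<rho>) + of_real (a x) + of_real (b x))) \<and>
    (mellin U (of_real \<rho>) \<noteq> 0 \<longrightarrow>
      (\<exists>a\<in>O[at_top](g). \<exists>b\<in>O[at_top](h). \<forall>\<^sub>F x in at_top.
         complex_of_real (mellin_conv U f x) =
           mellin U (of_real \<rho>) * of_real (x powr \<rho> * l x) * of_real (1 + a x + b x)))"
proof -
  define M where "M = Re (mellin U (of_real \<rho>))"
  have M: "mellin U (of_real \<rho>) = of_real M"
    by (simp add: M_def mellin_of_real)
  have dom: "of_real \<sigma> \<in> mellin_domain U" "of_real \<tau> \<in> mellin_domain U" "of_real \<rho> \<in> mellin_domain U"
    using assms(2,3,6) by auto
  obtain e where e: "e \<in> O[at_top](h)" "\<forall>\<^sub>F x in at_top. f x = x powr \<rho> * l x * (1 + e x)"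
    using assms(5) by blast
  obtain C where C: "C > 0" and ev: "\<forall>\<^sub>F x in at_top. \<forall>s>0. \<bar>f (x / s) - (x / s) powr \<rho> * l x\<bar> \<le>
    C * (s powr (-\<sigma>) + s powr (-\<tau>)) * (x powr \<rho> * l x * (g x + h x))"
    using regular_variation_uniform_bound[OF e _ _ assms(7-9,16)] assms(6) by auto
  \<comment> \<open>\<open>I\<close> does not depend on \<open>x\<close>, so \<open>I * C\<close>
    becomes the constant of the O-estimate.\<close>
  define I where "I = integral\<^sup>L (lebesgue_on {0<..}) (\<lambda>s. (s powr (-\<sigma>) + s powr (-\<tau>)) * \<bar>U s\<bar> / s)"
  have l: "l \<in> slowly_varying"
    using slowly_varying_rem_imp_slowly_varying[OF assms(7)] .
  have main: "\<forall>\<^sub>F x in at_top. mellin_conv_exists U f x \<and>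
    \<bar>mellin_conv U f x - x powr \<rho> * l x * M\<bar> \<le> I * (C * (x powr \<rho> * l x * (g x + h x)))"
    using ev eventually_gt_at_top[of 0]
  proof eventually_elim
    case (elim x)
    have "\<bar>f (x / s) - (x / s) powr \<rho> * l x\<bar> \<le>
      (s powr (-\<sigma>) + s powr (-\<tau>)) * (C * (x powr \<rho> * l x * (g x + h x)))" if "s > 0" for s
      using elim(1) that by (simp only: mult_ac)
    from mellin_conv_asymp_error[OF assms(1,4) dom elim(2) this]
    show ?case
      by (simp add: M_def I_def)
  qed
  \<comment> \<open>The error relative to \<open>x powr \<rho> * l x\<close>; the quotient is
    meaningful for large \<open>x\<close>, where \<open>l x > 0\<close>.\<close>
  define r where "r x = mellin_conv U f x / (x powr \<rho> * l x) - M" for x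
  have g0: "\<forall>\<^sub>F x in at_top. 0 \<le> g x"
    using slowly_varying_pos[OF assms(8)] by eventually_elim simp
  have h0: "\<forall>\<^sub>F x in at_top. 0 \<le> h x"
    using eventually_gt_at_top[of 0]
    by eventually_elim (use assms(9) in \<open>auto simp: zygmund_def nonneg_measurable_def\<close>)
  have r: "\<forall>\<^sub>F x in at_top. mellin_conv U f x = x powr \<rho> * l x * (M + r x)"
    using slowly_varying_pos[OF l] eventually_gt_at_top[of 0]
    by eventually_elim (simp add: r_def)
  have "r \<in> O[at_top](\<lambda>x. g x + h x)"
  proof (rule bigoI[of _ "I * C"])
    show "\<forall>\<^sub>F x in at_top. norm (r x) \<le> I * C * norm (g x + h x)"
      using main r slowly_varying_pos[OF l] eventually_gt_at_top[of 0] g0 h0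
    proof eventually_elim
      case (elim x)
      then have p: "x powr \<rho> * l x > 0"
        by simp
      have "x powr \<rho> * l x * \<bar>r x\<bar> = \<bar>x powr \<rho> * l x * r x\<bar>"
        by (simp only: abs_mult[of "x powr \<rho> * l x"] abs_of_pos[OF p])
      also have "x powr \<rho> * l x * r x = mellin_conv U f x - x powr \<rho> * l x * M"
        using elim(2) by (simp add: algebra_simps)
      also have "\<bar>\<dots>\<bar> \<le> x powr \<rho> * l x * (I * C * (g x + h x))"
        using elim(1) by (simp add: mult_ac)
      finally show ?case
        using p elim by simp
    qed
  qed
  then obtain a b where ab: "a \<in> O[at_top](g)" "b \<in> O[at_top](h)" "\<forall>\<^sub>F x in at_top. r x = a x + b x"
    using bigo_add_decompose[OF _ g0 h0] by blast
  have eq: "\<forall>\<^sub>F x in at_top. mellin_conv U f x = x powr \<rho> * l x * (M + a x + b x)"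
    using r ab(3) by eventually_elim (simp add: add.assoc)
  show ?thesis
  proof (intro conjI impI)
    show "\<forall>\<^sub>F x in at_top. mellin_conv_exists U f x"
      using main by eventually_elim simp
    show "\<exists>a\<in>O[at_top](g). \<exists>b\<in>O[at_top](h). \<forall>\<^sub>F x in at_top.
       complex_of_real (mellin_conv U f x) =
         of_real (x powr \<rho> * l x) * (mellin U (of_real \<rho>) + of_real (a x) + of_real (b x))"
      using eq ab(1,2) by (intro bexI[of _ a] bexI[of _ b]) (auto simp: M elim!: eventually_mono)
  next
    assume "mellin U (of_real \<rho>) \<noteq> 0"
    then have M0: "M \<noteq> 0"
      by (simp add: M)
    have "(\<lambda>x. a x / M) \<in> O[at_top](g)" "(\<lambda>x. b x / M) \<in> O[at_top](h)"
      using ab(1,2) M0 by auto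
    moreover have "\<forall>\<^sub>F x in at_top. complex_of_real (mellin_conv U f x) =
         mellin U (of_real \<rho>) * of_real (x powr \<rho> * l x) * of_real (1 + a x / M + b x / M)"
      using eq
    proof eventually_elim
      case (elim x)
      have "mellin_conv U f x = M * (x powr \<rho> * l x) * (1 + a x / M + b x / M)"
        using elim M0 by (simp add: field_simps)
      then show ?case
        unfolding M by (simp only: of_real_mult)
    qed
    ultimately show "\<exists>a\<in>O[at_top](g). \<exists>b\<in>O[at_top](h). \<forall>\<^sub>F x in at_top.
         complex_of_real (mellin_conv U f x) =
           mellin U (of_real \<rho>) * of_real (x powr \<rho> * l x) * of_real (1 + a x + b x)"
      by (intro bexI[of _ "\<lambda>x. a x / M"] bexI[of _ "\<lambda>x. b x / M"])
  qed
qed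

end
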